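(* For each even $n$, there exists a proper synchronizing complete deterministic finite automaton with $n$ states and $3$ input letters whose reset threshold equals $\frac{n^2}{2}-2n+2$ and whose input letters are idempotents of rank $\frac{n}{2}$.
   Context: A complete deterministic finite automaton (DFA) $\langle Q,\Sigma\rangle$ consists of a finite state set $Q$, a finite input alphabet $\Sigma$, and a totally defined transition function $Q\times\Sigma\to Q$, written $(q,a)\mapsto q.a$. It extends to words $w\in\Sigma^*$ (finite words, including the empty word) by $q.w:=q$ if $w$ is empty and $q.(va):=(q.v).a$ for $v\in\Sigma^*$, $a\in\Sigma$. A word $w\in\Sigma^*$ is a reset word for the DFA if $q.w=q'.w$ for all $q,q'\in Q$. The DFA is synchronizing if it has a reset word; its reset threshold is then the minimum length of its reset words. A letter $a\in\Sigma$ is idempotent if $(q.a).a=q.a$ for every $q\in Q$, and its rank is the cardinality of $Q.a=\{q.a\mid q\in Q\}$. A synchronizing automaton with $|\Sigma|>2$ is proper if for every letter $a\in\Sigma$ the DFA obtained by removing $a$ from the input alphabet (and restricting the transition function accordingly) is not synchronizing; in other terms, every reset word of the automaton involves all letters of $\Sigma$.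
   Formalization: Stated for even n ≥ 6 rather than each even n: for n = 0, 2, 4 the claim is false, since every reset word of a proper automaton with 3 letters uses all 3 letters, so the reset threshold is at least 3, while n²/2 − 2n + 2 equals 2, 0, 2. *)

theory Defs
  imports Complex_Main
begin

record ('q, 'a) dfa =
  states :: "'q set"
  alphabet :: "'a set"
  trans :: "'q \<Rightarrow> 'a \<Rightarrow> 'q"

text \<open>
  The values of \<open>trans\<close> outside \<open>states \<times> alphabet\<close> are irrelevant: every notion below
  evaluates it on states and letters of the automaton only.
\<close>

definition complete_dfa :: "('q, 'a) dfa \<Rightarrow> bool" where
  "complete_dfa A \<longleftrightarrow> finite (states A) \<and> finite (alphabet A) \<and>
     (\<forall>q\<in>states A. \<forall>a\<in>alphabet A. trans A q a \<in> states A)"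

definition act :: "('q, 'a) dfa \<Rightarrow> 'q \<Rightarrow> 'a list \<Rightarrow> 'q" where
  "act A q w = foldl (trans A) q w"

definition reset_word :: "('q, 'a) dfa \<Rightarrow> 'a list \<Rightarrow> bool" where
  "reset_word A w \<longleftrightarrow> w \<in> lists (alphabet A) \<and>
     (\<forall>q\<in>states A. \<forall>q'\<in>states A. act A q w = act A q' w)"

definition synchronizing :: "('q, 'a) dfa \<Rightarrow> bool" where
  "synchronizing A \<longleftrightarrow> (\<exists>w. reset_word A w)"

text \<open>Meaningful for synchronizing automata only.\<close>

definition reset_threshold :: "('q, 'a) dfa \<Rightarrow> nat" where
  "reset_threshold A = (LEAST k. \<exists>w. reset_word A w \<and> length w = k)"

definition idempotent_letter :: "('q, 'a) dfa \<Rightarrow> 'a \<Rightarrow> bool" where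
  "idempotent_letter A a \<longleftrightarrow> (\<forall>q\<in>states A. trans A (trans A q a) a = trans A q a)"

definition letter_rank :: "('q, 'a) dfa \<Rightarrow> 'a \<Rightarrow> nat" where
  "letter_rank A a = card ((\<lambda>q. trans A q a) ` states A)"

definition remove_letter :: "'a \<Rightarrow> ('q, 'a) dfa \<Rightarrow> ('q, 'a) dfa" where
  "remove_letter a A = A\<lparr>alphabet := alphabet A - {a}\<rparr>"

definition proper_synchronizing :: "('q, 'a) dfa \<Rightarrow> bool" where
  "proper_synchronizing A \<longleftrightarrow> synchronizing A \<and> card (alphabet A) > 2 \<and>
     (\<forall>a\<in>alphabet A. \<not> synchronizing (remove_letter a A))"

lemma act_Nil: "act A q [] = q"
  by (simp add: act_def)

lemma act_snoc: "act A q (v @ [a]) = trans A (act A q v) a"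
  by (simp add: act_def)

lemma reset_word_remove_letter:
  "reset_word (remove_letter a A) w \<longleftrightarrow> reset_word A w \<and> a \<notin> set w"
  by (auto simp: reset_word_def remove_letter_def act_def in_lists_conv_set)

lemma proper_synchronizing_iff:
  "proper_synchronizing A \<longleftrightarrow> synchronizing A \<and> card (alphabet A) > 2 \<and>
     (\<forall>w. reset_word A w \<longrightarrow> set w = alphabet A)"
proof -
  have "set w \<subseteq> alphabet A" if "reset_word A w" for w
    using that by (auto simp: reset_word_def)
  then show ?thesis
    unfolding proper_synchronizing_def synchronizing_def reset_word_remove_letter by blast
qed

text \<open>
  A reset word of a proper synchronizing automaton uses every letter, so with three letters the
  reset threshold is at least 3, whereas \<open>n\<^sup>2/2 - 2n + 2\<close> equals 2, 0, 2 for \<open>n = 0, 2, 4\<close>.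
  Hence \<open>n = 6\<close> is the smallest even number of states for which this value can be the reset
  threshold.
\<close>

lemma card_alphabet_le_reset_threshold:
  assumes "proper_synchronizing A"
  shows "card (alphabet A) \<le> reset_threshold A"
proof -
  have "\<exists>w. reset_word A w \<and> length w = reset_threshold A"
    unfolding reset_threshold_def
    by (rule LeastI_ex) (use assms in \<open>auto simp: proper_synchronizing_def synchronizing_def\<close>)
  then obtain w where "reset_word A w" "length w = reset_threshold A" by blast
  with assms show ?thesis
    unfolding proper_synchronizing_iff by (metis card_length)
qed

lemma proper_three_letters_threshold_imp_ge_6:
  assumes "proper_synchronizing A" "card (alphabet A) = 3" "even n"
    and "real (reset_threshold A) = real n ^ 2 / 2 - 2 * real n + 2"
  shows "n \<ge> 6"
proof (rule ccontr)
  assume "\<not> n \<ge> 6"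
  with \<open>even n\<close> have "n = 0 \<or> n = 2 \<or> n = 4" by presburger
  moreover have "real (reset_threshold A) \<ge> 3"
    using card_alphabet_le_reset_threshold[OF assms(1)] assms(2) by simp
  ultimately show False using assms(4) by auto
qed

end

(* Higgins' doubling: adjoin to a DFA on Q a primed copy Q' of Q, a letter retracting Q' onto Q,
   and for each letter a the idempotent that sends q to (q.a)' and fixes Q'. Only words in which
   the retraction alternates with the other letters make progress, so the reset threshold doubles.
   Apply this to the Cerny automaton with m = n/2 states, whose reset threshold is (m - 1)^2.
   For its lower bound, follow an arc of the cycle that avoids the current image. *)
theory Submission
  imports Defs
begin

section \<open>Word actions and reset thresholds\<close>

lemma act_Cons: "act A q (a # w) = act A (trans A q a) w"
  by (simp add: act_def)

lemma act_append: "act A q (v @ w) = act A (act A q v) w"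
  by (simp add: act_def)

lemma act_in_states:
  assumes "complete_dfa A" "q \<in> states A" "set w \<subseteq> alphabet A"
  shows "act A q w \<in> states A"
  using assms(2,3)
  by (induction w arbitrary: q)
     (use assms(1) in \<open>auto simp: act_Nil act_Cons complete_dfa_def\<close>)

lemma reset_threshold_eqI:
  assumes "reset_word A w" and "length w = k"
    and "\<And>v. reset_word A v \<Longrightarrow> k \<le> length v"
  shows "reset_threshold A = k"
  unfolding reset_threshold_def using assms by (intro Least_equality) auto

lemma reset_threshold_le:
  assumes "reset_word A w"
  shows "reset_threshold A \<le> length w"
  unfolding reset_threshold_def using assms by (intro Least_le) blast

lemma shortest_reset_word:
  assumes "synchronizing A"
  obtains w where "reset_word A w" "length w = reset_threshold A"
proof -
  have "\<exists>w. reset_word A w \<and> length w = reset_threshold A"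
    unfolding reset_threshold_def
    by (rule LeastI_ex) (use assms in \<open>auto simp: synchronizing_def\<close>)
  with that show thesis by blast
qed

section \<open>Doubling an automaton\<close>

text \<open>
  For a DFA \<open>B\<close> with state set \<open>{..<m}\<close>, the state \<open>m + q\<close> is the primed copy of \<open>q\<close>,
  letter 0 is the retraction onto the unprimed copy, and \<open>Suc a\<close> is the idempotent that
  encodes the letter \<open>a\<close> of \<open>B\<close>.
\<close>

definition double :: "nat \<Rightarrow> (nat, nat) dfa \<Rightarrow> (nat, nat) dfa" where
  "double m B = \<lparr>states = {..<2 * m}, alphabet = insert 0 (Suc ` alphabet B),
     trans = (\<lambda>q x. case x of
         0 \<Rightarrow> if q < m then q else q - m
       | Suc a \<Rightarrow> if q < m then m + trans B q a else q)\<rparr>"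

lemma double_sel [simp]:
  "states (double m B) = {..<2 * m}"
  "alphabet (double m B) = insert 0 (Suc ` alphabet B)"
  "trans (double m B) q 0 = (if q < m then q else q - m)"
  "trans (double m B) q (Suc a) = (if q < m then m + trans B q a else q)"
  by (simp_all add: double_def)

definition interleave :: "nat list \<Rightarrow> nat list" where
  "interleave v = concat (map (\<lambda>a. [0, Suc a]) v)"

lemma interleave_simps [simp]:
  "interleave [] = []"
  "interleave (a # v) = 0 # Suc a # interleave v"
  by (simp_all add: interleave_def)

lemma length_interleave [simp]: "length (interleave v) = 2 * length v"
  by (induction v) auto

lemma set_interleave: "set (interleave v) \<subseteq> insert 0 (Suc ` set v)"
  by (induction v) auto

locale doubled_dfa =
  fixes m :: nat and B :: "(nat, nat) dfa"
  assumes complete: "complete_dfa B" and states_B [simp]: "states B = {..<m}"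
begin

lemma trans_less: "q < m \<Longrightarrow> a \<in> alphabet B \<Longrightarrow> trans B q a < m"
  using complete by (auto simp: complete_dfa_def)

lemma act_less: "q < m \<Longrightarrow> set v \<subseteq> alphabet B \<Longrightarrow> act B q v < m"
  using act_in_states[OF complete] by auto

lemma complete_double: "complete_dfa (double m B)"
  using complete by (force simp: complete_dfa_def)

lemma card_alphabet_double: "card (alphabet (double m B)) = Suc (card (alphabet B))"
  using complete by (auto simp: complete_dfa_def card_image)

lemma idempotent_double: "x \<in> alphabet (double m B) \<Longrightarrow> idempotent_letter (double m B) x"
  by (auto simp: idempotent_letter_def)

text \<open>Each image is one of the two copies: letter 0 retracts onto the unprimed states, every
  other letter onto the primed ones.\<close>

lemma letter_rank_double:
  assumes "x \<in> alphabet (double m B)"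
  shows "letter_rank (double m B) x = m"
proof (cases x)
  case 0
  have "(\<lambda>q. trans (double m B) q x) ` {..<2 * m} = {..<m}"
    unfolding 0 by (force simp: image_iff)
  then show ?thesis by (simp add: letter_rank_def)
next
  case (Suc a)
  with assms have "a \<in> alphabet B" by auto
  then have "(\<lambda>q. trans (double m B) q x) ` {..<2 * m} = {m..<2 * m}"
    unfolding Suc using trans_less by (force simp: image_iff)
  then show ?thesis by (simp add: letter_rank_def)
qed

lemma act_double_interleave:
  assumes "q < m" "set v \<subseteq> alphabet B"
  shows "act (double m B) (m + q) (interleave v) = m + act B q v"
  using assms by (induction v arbitrary: q) (auto simp: act_Nil act_Cons trans_less)

text \<open>The hypothesis \<open>v \<noteq> []\<close> matters for \<open>m = 1\<close>: the empty
  word resets \<open>B\<close>, but not its double, which has two states.\<close>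

lemma reset_word_interleave:
  assumes "reset_word B v" "v \<noteq> []"
  shows "reset_word (double m B) (interleave v)"
proof -
  have v: "set v \<subseteq> alphabet B"
    and sync: "\<And>p q. p < m \<Longrightarrow> q < m \<Longrightarrow> act B p v = act B q v"
    using assms(1) unfolding reset_word_def states_B lists_eq_set by blast+
  have act: "act (double m B) q (interleave v) = m + act B (if q < m then q else q - m) v"
    if "q < 2 * m" for q
  proof (cases "q < m")
    case True
    \<comment> \<open>The leading letter 0 identifies \<open>q\<close> with its primed copy.\<close>
    have "act (double m B) q (interleave v) = act (double m B) (m + q) (interleave v)"
      using \<open>v \<noteq> []\<close> True by (cases v) (auto simp: act_Cons)
    then show ?thesis using act_double_interleave[OF True v] True by simp
  next
    case False
    with that act_double_interleave[of "q - m" v] v show ?thesis by simp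
  qed
  show ?thesis
    unfolding reset_word_def
  proof (intro conjI ballI)
    show "interleave v \<in> lists (alphabet (double m B))"
      using set_interleave[of v] v by (auto simp: in_lists_conv_set)
  next
    fix p q assume "p \<in> states (double m B)" "q \<in> states (double m B)"
    then have pq: "p < 2 * m" "q < 2 * m" by auto
    have "act B (if p < m then p else p - m) v = act B (if q < m then q else q - m) v"
      by (rule sync) (use pq in auto)
    then show "act (double m B) p (interleave v) = act (double m B) q (interleave v)"
      by (simp only: act pq)
  qed
qed

text \<open>
  From the primed copy a letter \<open>Suc a\<close> takes effect only after a letter 0, which is where the
  factor 2 comes from.
\<close>

lemma double_simulates:
  assumes "set w \<subseteq> alphabet (double m B)"
  shows "\<exists>v. set v \<subseteq> alphabet B \<and> Suc ` set v \<subseteq> set w \<and> (v \<noteq> [] \<longrightarrow> 0 \<in> set w) \<and>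
    ((\<forall>q<m. act (double m B) (m + q) w = m + act B q v) \<and> 2 * length v \<le> length w \<or>
     (\<forall>q<m. act (double m B) (m + q) w = act B q v) \<and> 0 \<in> set w \<and>
       2 * length v + 1 \<le> length w)"
  using assms
proof (induction w rule: rev_induct)
  case Nil
  show ?case by (intro exI[of _ "[]"]) (auto simp: act_Nil)
next
  case (snoc x w)
  then obtain v where v: "set v \<subseteq> alphabet B" "Suc ` set v \<subseteq> set w" "v \<noteq> [] \<longrightarrow> 0 \<in> set w"
    and "(\<forall>q<m. act (double m B) (m + q) w = m + act B q v) \<and> 2 * length v \<le> length w \<or>
     (\<forall>q<m. act (double m B) (m + q) w = act B q v) \<and> 0 \<in> set w \<and>
       2 * length v + 1 \<le> length w"
    by auto
  then consider
      (primed) "\<forall>q<m. act (double m B) (m + q) w = m + act B q v" "2 * length v \<le> length w"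
    | (unprimed) "\<forall>q<m. act (double m B) (m + q) w = act B q v" "0 \<in> set w"
       "2 * length v + 1 \<le> length w"
    by blast
  then show ?case
  proof cases
    case primed
    \<comment> \<open>Letter 0 leads to the unprimed alternative with the same \<open>v\<close>;
      every other letter fixes the primed states.\<close>
    then show ?thesis using v
      by (intro exI[of _ v]) (cases x; auto simp: act_snoc)
  next
    case unprimed
    note less = act_less[OF _ v(1)]
    show ?thesis
    proof (cases x)
      case 0
      then show ?thesis using unprimed v less
        by (intro exI[of _ v]) (auto simp: act_snoc)
    next
      case (Suc a)
      with snoc.prems have "a \<in> alphabet B" by auto
      \<comment> \<open>Only here does \<open>v\<close> grow: the spare letter recorded by
        \<open>+ 1\<close> and the letter \<open>x\<close> together pay for one letter of
        \<open>B\<close>.\<close>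
      with Suc show ?thesis using unprimed v less
        by (intro exI[of _ "v @ [a]"]) (auto simp: act_snoc)
    qed
  qed
qed

text \<open>It suffices to look at the primed copy: in both alternatives of
  \<open>double_simulates\<close> the value determines \<open>act B q v\<close>, so \<open>v\<close>
  merges all states. The two facts on \<open>set w\<close> serve properness.\<close>

lemma reset_word_double_imp:
  assumes "reset_word (double m B) w"
  obtains v where "reset_word B v" "Suc ` set v \<subseteq> set w" "v \<noteq> [] \<Longrightarrow> 0 \<in> set w"
    "2 * length v \<le> length w"
proof -
  have w: "set w \<subseteq> alphabet (double m B)"
    and sync: "\<And>p q. p < m \<Longrightarrow> q < m \<Longrightarrow>
      act (double m B) (m + p) w = act (double m B) (m + q) w"
    using assms by (auto simp: reset_word_def)
  obtain v where v: "set v \<subseteq> alphabet B" "Suc ` set v \<subseteq> set w" "v \<noteq> [] \<longrightarrow> 0 \<in> set w"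
      "2 * length v \<le> length w"
    and cases: "(\<forall>q<m. act (double m B) (m + q) w = m + act B q v) \<or>
      (\<forall>q<m. act (double m B) (m + q) w = act B q v)"
    using double_simulates[OF w] by fastforce
  have "act B p v = act B q v" if "p < m" "q < m" for p q
    using cases sync[OF that] that by auto
  with v(1) have "reset_word B v"
    unfolding reset_word_def states_B lists_eq_set by blast
  with v that show thesis by blast
qed

lemma reset_word_nonempty:
  assumes "reset_word B v" "m \<ge> 2"
  shows "v \<noteq> []"
proof
  assume "v = []"
  with assms(1) have "\<forall>p<m. \<forall>q<m. p = q" by (simp add: reset_word_def act_Nil)
  then have "(0::nat) = 1" using \<open>m \<ge> 2\<close> by (metis Suc_1 Suc_le_eq less_trans zero_less_one)
  then show False by simp
qed

lemma reset_threshold_double: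
  assumes "synchronizing B" "m \<ge> 2"
  shows "reset_threshold (double m B) = 2 * reset_threshold B"
proof -
  obtain v where v: "reset_word B v" "length v = reset_threshold B"
    using shortest_reset_word[OF assms(1)] .
  show ?thesis
  proof (rule reset_threshold_eqI)
    show "reset_word (double m B) (interleave v)"
      using v assms by (intro reset_word_interleave reset_word_nonempty)
    show "length (interleave v) = 2 * reset_threshold B" using v by simp
  next
    fix w assume "reset_word (double m B) w"
    then obtain u where "reset_word B u" "2 * length u \<le> length w"
      using reset_word_double_imp by metis
    then show "2 * reset_threshold B \<le> length w"
      using reset_threshold_le[of B u] by linarith
  qed
qed

text \<open>The simulated word \<open>v\<close> forces all letters \<open>Suc a\<close> into
  \<open>w\<close>, and being nonempty it also forces letter 0.\<close>

lemma proper_double: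
  assumes "synchronizing B" "m \<ge> 2" "card (alphabet B) \<ge> 2"
    and all: "\<And>v. reset_word B v \<Longrightarrow> set v = alphabet B"
  shows "proper_synchronizing (double m B)"
  unfolding proper_synchronizing_iff
proof (intro conjI allI impI)
  show "synchronizing (double m B)"
    using assms(1,2) reset_word_interleave reset_word_nonempty
    unfolding synchronizing_def by blast
  show "card (alphabet (double m B)) > 2"
    using assms(3) card_alphabet_double by simp
next
  fix w assume w: "reset_word (double m B) w"
  then obtain v where "reset_word B v" "Suc ` set v \<subseteq> set w" "v \<noteq> [] \<Longrightarrow> 0 \<in> set w"
    using reset_word_double_imp by metis
  with all reset_word_nonempty[of v] \<open>m \<ge> 2\<close>
  have "alphabet (double m B) \<subseteq> set w" by auto
  moreover have "set w \<subseteq> alphabet (double m B)"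
    using w by (auto simp: reset_word_def)
  ultimately show "set w = alphabet (double m B)" by blast
qed

end

section \<open>The Cerny automata\<close>

definition cerny :: "nat \<Rightarrow> (nat, nat) dfa" where
  "cerny m = \<lparr>states = {..<m}, alphabet = {0, 1},
     trans = (\<lambda>q x. if x = 0 then (if Suc q = m then 0 else Suc q) else (if q = 0 then 1 else q))\<rparr>"

lemma cerny_sel [simp]:
  "states (cerny m) = {..<m}"
  "alphabet (cerny m) = {0, 1}"
  "trans (cerny m) q 0 = (if Suc q = m then 0 else Suc q)"
  "trans (cerny m) q (Suc 0) = (if q = 0 then 1 else q)"
  by (simp_all add: cerny_def)

lemma complete_cerny: "m \<ge> 2 \<Longrightarrow> complete_dfa (cerny m)"
  by (auto simp: complete_dfa_def)

lemma act_cerny_less: "m \<ge> 2 \<Longrightarrow> q < m \<Longrightarrow> set w \<subseteq> {0, 1} \<Longrightarrow> act (cerny m) q w < m"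
  using act_in_states[OF complete_cerny] by auto

section \<open>A reset word attaining the Cerny bound\<close>

lemma act_cerny_rotate:
  assumes "q < m" "k \<le> m"
  shows "act (cerny m) q (replicate k 0) = (if q + k < m then q + k else q + k - m)"
  using assms(2)
proof (induction k)
  case 0
  then show ?case using assms(1) by (simp add: act_Nil)
next
  case (Suc k)
  have "act (cerny m) q (replicate (Suc k) 0) = trans (cerny m) (act (cerny m) q (replicate k 0)) 0"
    by (simp add: act_snoc flip: replicate_append_same)
  with Suc assms(1) show ?case by auto
qed

text \<open>The subtraction is truncated: a round fixes the state 0.\<close>

lemma act_cerny_rounds:
  assumes "m \<ge> 2" "q < m"
  shows "act (cerny m) q (concat (replicate k (1 # replicate (m - 1) 0))) = q - k"
  using assms(2)
proof (induction k arbitrary: q)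
  case 0
  show ?case by (simp add: act_Nil)
next
  case (Suc k)
  \<comment> \<open>Rotating \<open>m - 1\<close> times is one step back on the cycle; state 0 goes
    to 1 and returns.\<close>
  have "act (cerny m) q (1 # replicate (m - 1) 0) = q - 1"
    using \<open>m \<ge> 2\<close> Suc.prems by (auto simp: act_Cons act_cerny_rotate)
  with Suc show ?case
    by (simp add: act_append del: One_nat_def append_Cons)
qed

text \<open>After \<open>m - 2\<close> rounds every state is at 0 or 1, and the last letter merges
  these two.\<close>

lemma reset_word_cerny:
  assumes "m \<ge> 2"
  shows "reset_word (cerny m) (concat (replicate (m - 2) (1 # replicate (m - 1) 0)) @ [1])"
proof -
  have "act (cerny m) q (concat (replicate (m - 2) (1 # replicate (m - 1) 0)) @ [1]) = 1"
    if "q < m" for q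
    using that assms
    by (auto simp: act_append act_cerny_rounds act_Cons act_Nil simp del: One_nat_def) auto
  moreover have "set (concat (replicate (m - 2) (1 # replicate (m - 1) 0)) @ [1]) \<subseteq> {0, 1}"
    by auto
  ultimately show ?thesis
    unfolding reset_word_def cerny_sel lists_eq_set
    by (intro conjI ballI) (simp_all only: mem_Collect_eq lessThan_iff)
qed

lemma length_reset_word_cerny:
  assumes "m \<ge> 2"
  shows "length (concat (replicate (m - 2) (1 # replicate (m - 1) (0::nat))) @ [1]) = (m - 1)\<^sup>2"
proof -
  \<comment> \<open>The count is \<open>(m - 2) * m + 1\<close>; substituting for \<open>m\<close>
    removes truncated subtraction.\<close>
  obtain k where "m = k + 2" using assms by (metis le_add_diff_inverse2)
  then show ?thesis
    by (simp add: length_concat sum_list_replicate power2_eq_square algebra_simps)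
qed

section \<open>Lower bound for the Cerny automata\<close>

text \<open>For \<open>y, p < m\<close> this is the residue of \<open>y - p\<close> modulo
  \<open>m\<close>, the number of rotations from \<open>p\<close> to \<open>y\<close>.\<close>

definition back_dist :: "nat \<Rightarrow> nat \<Rightarrow> nat \<Rightarrow> nat" where
  "back_dist m y p = (if p \<le> y then y - p else y + m - p)"

text \<open>
  The arc of length \<open>g\<close> that ends in \<open>y\<close> misses the image of \<open>w\<close> iff all backward distances
  from \<open>y\<close> are at least \<open>g\<close>. The potential \<open>g * m + y\<close> of such an arc grows by at most one per
  letter: rotation moves its end, and the other letter lengthens an arc only if that arc ends
  in \<open>m - 1\<close>, while it resets the end from \<open>m - 1\<close> to 0.
\<close>

lemma cerny_gap_potential:
  assumes "m \<ge> 2" "set w \<subseteq> {0, 1}" "y < m"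
    and "\<And>q. q < m \<Longrightarrow> g \<le> back_dist m y (act (cerny m) q w)"
  shows "g * m + y \<le> m - 1 + length w"
  using assms(2-4)
proof (induction w arbitrary: g y rule: rev_induct)
  case Nil
  \<comment> \<open>The empty word has \<open>y\<close> itself in its image, at distance 0.\<close>
  then have "g = 0" using Nil(3)[of y] by (simp add: act_Nil back_dist_def)
  with Nil show ?case by simp
next
  case (snoc x w)
  have less: "act (cerny m) q w < m" if "q < m" for q
    using snoc.prems(1) that \<open>m \<ge> 2\<close> by (intro act_cerny_less) auto
  have gap: "g \<le> back_dist m y (trans (cerny m) (act (cerny m) q w) x)" if "q < m" for q
    using snoc.prems(3)[OF that] by (simp add: act_snoc)
  have IH: "g' * m + y' \<le> m - 1 + length w"
    if "y' < m" "\<And>q. q < m \<Longrightarrow> g' \<le> back_dist m y' (act (cerny m) q w)" for g' y'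
    using snoc.IH snoc.prems(1) that by auto
  consider "x = 0" "y = 0" | "x = 0" "y > 0" | "x = 1" "y = 0" "g > 0" | "x = 1" "y > 0" | "g = 0"
    using snoc.prems(1) by auto
  then show ?case
  proof cases
    case 1
    \<comment> \<open>Undoing the rotation moves the end of the arc from 0 back to
      \<open>m - 1\<close>.\<close>
    have "g * m + (m - 1) \<le> m - 1 + length w"
    proof (rule IH)
      fix q assume "q < m"
      with gap[OF this] less[OF this] snoc.prems(2) 1 show "g \<le> back_dist m (m - 1) (act (cerny m) q w)"
        by (auto simp: back_dist_def split: if_splits)
    qed (use \<open>m \<ge> 2\<close> in simp)
    with 1 show ?thesis by simp
  next
    case 2
    have "g * m + (y - 1) \<le> m - 1 + length w"
    proof (rule IH)
      fix q assume "q < m"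
      with gap[OF this] less[OF this] snoc.prems(2) 2 show "g \<le> back_dist m (y - 1) (act (cerny m) q w)"
        by (auto simp: back_dist_def split: if_splits)
    qed (use \<open>y < m\<close> in simp)
    with 2 show ?thesis by simp
  next
    case 3
    \<comment> \<open>Letter 1 empties state 0, so before it only the other \<open>g - 1\<close>
      states of the arc, ending in \<open>m - 1\<close>, must be missed.\<close>
    have "(g - 1) * m + (m - 1) \<le> m - 1 + length w"
    proof (rule IH)
      fix q assume "q < m"
      with gap[OF this] less[OF this] snoc.prems(2) 3 show "g - 1 \<le> back_dist m (m - 1) (act (cerny m) q w)"
        by (auto simp: back_dist_def split: if_splits)
    qed (use \<open>m \<ge> 2\<close> in simp)
    moreover have "g * m = (g - 1) * m + m" using 3 by (cases g) auto
    ultimately show ?thesis using 3 \<open>m \<ge> 2\<close> by simp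
  next
    case 4
    \<comment> \<open>If 0 was in the image, then 1 is now, one step closer to \<open>y\<close>; so
      the same arc was missed before.\<close>
    have "g * m + y \<le> m - 1 + length w"
    proof (rule IH)
      fix q assume "q < m"
      with gap[OF this] less[OF this] snoc.prems(2) 4 show "g \<le> back_dist m y (act (cerny m) q w)"
        by (auto simp: back_dist_def split: if_splits)
    qed (use \<open>y < m\<close> in simp)
    then show ?thesis by simp
  next
    case 5
    with \<open>y < m\<close> show ?thesis by simp
  qed
qed

lemma length_ge_if_reset_word_cerny:
  assumes "m \<ge> 2" "reset_word (cerny m) w"
  shows "(m - 1)\<^sup>2 \<le> length w"
proof -
  have w: "set w \<subseteq> {0, 1}"
    and sync: "\<And>p q. p < m \<Longrightarrow> q < m \<Longrightarrow> act (cerny m) p w = act (cerny m) q w"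
    using assms unfolding reset_word_def cerny_sel lists_eq_set by blast+
  define s where "s = act (cerny m) 0 w"
  \<comment> \<open>With \<open>y\<close> the predecessor of \<open>s\<close>, the missed arc is the
    whole cycle except \<open>s\<close>.\<close>
  define y where "y = (if s = 0 then m - 1 else s - 1)"
  have "s < m" unfolding s_def using assms w by (intro act_cerny_less) auto
  have "(m - 1) * m + y \<le> m - 1 + length w"
  proof (rule cerny_gap_potential[OF \<open>m \<ge> 2\<close> w])
    show "y < m" using \<open>s < m\<close> by (auto simp: y_def)
    fix q assume "q < m"
    then have "act (cerny m) q w = s"
      unfolding s_def using \<open>m \<ge> 2\<close> by (intro sync) auto
    then show "m - 1 \<le> back_dist m y (act (cerny m) q w)"
      using \<open>s < m\<close> by (auto simp: back_dist_def y_def)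
  qed
  moreover have "(m - 1) * m = (m - 1)\<^sup>2 + (m - 1)"
    using \<open>m \<ge> 2\<close> by (cases m) (auto simp: power2_eq_square)
  ultimately show ?thesis by linarith
qed

lemma reset_threshold_cerny: "m \<ge> 2 \<Longrightarrow> reset_threshold (cerny m) = (m - 1)\<^sup>2"
  using reset_word_cerny length_reset_word_cerny length_ge_if_reset_word_cerny
  by (intro reset_threshold_eqI)

lemma act_cerny_rotations_inj:
  assumes "set w \<subseteq> {0}" "p < m" "q < m" "p \<noteq> q"
  shows "act (cerny m) p w \<noteq> act (cerny m) q w"
  using assms by (induction w arbitrary: p q) (auto simp: act_Nil act_Cons)

lemma act_cerny_fixed:
  assumes "set w \<subseteq> {1}" "q > 0"
  shows "act (cerny m) q w = q"
  using assms by (induction w) (auto simp: act_Nil act_Cons)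

text \<open>Rotations are injective, and letter 1 fixes both 1 and 2. For \<open>m = 2\<close> the
  word \<open>[1]\<close> is a reset word.\<close>

lemma set_reset_word_cerny:
  assumes "m \<ge> 3" "reset_word (cerny m) w"
  shows "set w = alphabet (cerny m)"
proof -
  have w: "set w \<subseteq> {0, 1}"
    and sync: "\<And>p q. p < m \<Longrightarrow> q < m \<Longrightarrow> act (cerny m) p w = act (cerny m) q w"
    using assms unfolding reset_word_def cerny_sel lists_eq_set by blast+
  have "\<not> set w \<subseteq> {0}"
    using act_cerny_rotations_inj[of w 1 m 2] sync[of 1 2] \<open>m \<ge> 3\<close> by auto
  moreover have "\<not> set w \<subseteq> {1}"
    using act_cerny_fixed[of w 1 m] act_cerny_fixed[of w 2 m] sync[of 1 2] \<open>m \<ge> 3\<close> by auto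
  ultimately show ?thesis using w by auto
qed

theorem corollary3:
  fixes n :: nat
  assumes "even n" and "n \<ge> 6"
  shows "\<exists>A :: (nat, nat) dfa.
    complete_dfa A \<and> card (states A) = n \<and> card (alphabet A) = 3 \<and>
    proper_synchronizing A \<and>
    real (reset_threshold A) = real n ^ 2 / 2 - 2 * real n + 2 \<and>
    (\<forall>a\<in>alphabet A. idempotent_letter A a \<and> real (letter_rank A a) = real n / 2)"
proof -
  obtain m where n: "n = 2 * m" using \<open>even n\<close> by blast
  with \<open>n \<ge> 6\<close> have m: "m \<ge> 3" by simp
  interpret doubled_dfa m "cerny m"
    using m by unfold_locales (auto intro: complete_cerny)
  have sync: "synchronizing (cerny m)"
    using m reset_word_cerny[of m] by (auto simp: synchronizing_def)
  have "reset_threshold (double m (cerny m)) = 2 * (m - 1)\<^sup>2"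
    using m sync by (simp add: reset_threshold_double reset_threshold_cerny)
  then have "real (reset_threshold (double m (cerny m))) = 2 * (real m - 1)\<^sup>2"
    using m by (simp add: of_nat_diff)
  \<comment> \<open>Substituting \<open>n = 2 * m\<close>, both sides equal
    \<open>2 * m\<^sup>2 - 4 * m + 2\<close>.\<close>
  then have "real (reset_threshold (double m (cerny m))) = real n ^ 2 / 2 - 2 * real n + 2"
    by (simp add: n power2_eq_square algebra_simps)
  moreover have "proper_synchronizing (double m (cerny m))"
    using m by (intro proper_double sync set_reset_word_cerny) auto
  moreover have "card (alphabet (double m (cerny m))) = 3"
    using card_alphabet_double by simp
  moreover have "\<forall>a\<in>alphabet (double m (cerny m)). idempotent_letter (double m (cerny m)) a \<and>
      real (letter_rank (double m (cerny m)) a) = real n / 2"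
    using idempotent_double letter_rank_double n by auto
  ultimately show ?thesis
    using complete_double n by (intro exI[of _ "double m (cerny m)"]) simp
qed

end
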